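(* Let $(Z,\rho)$ be a quasi-metric space. Then the following conditions are quantitatively equivalent. (1) $(Z,\rho)$ is $\mu$-uniformly perfect (for some $\mu\in(0,1)$). (2) $(Z,\rho)$ is $(\lambda_1,\lambda_2)$-HD (for some $0<\lambda_1\le\lambda_2<1$). (3) $(Z,\rho)$ is $\sigma$-dense (for some $\sigma>1$). (4) There are numbers $\mu_1,\mu_2$ with $0<\mu_1\le\mu_2<1$ such that for any triple $(a,c,d)$ of distinct points in $Z$ there is a point $x\in Z$ satisfying $\mu_1\le r(a,x,c,d)\le\mu_2$.
   Context: For $K>1$, a $K$-quasi-metric on a set $Z$ is a function $\rho:Z\times Z\to[0,\infty)$ such that $\rho(x,y)=0$ iff $x=y$, $\rho(x,y)=\rho(y,x)$, and $\rho(x,z)\le K\max\{\rho(x,y),\rho(y,z)\}$ for all $x,y,z\in Z$. A quasi-metric space is a pair $(Z,\rho)$ with $\rho$ a $K$-quasi-metric for some $K>1$; $K$ is called its quasi-metric coefficient. Write $\mathbb{B}(x,r)=\{y\in Z:\rho(x,y)<r\}$. Convergence $x_i\to a$ means $\rho(x_i,a)\to 0$. Cross ratio: $r(a,b,c,d)=\dfrac{\rho(a,c)\,\rho(b,d)}{\rho(a,b)\,\rho(c,d)}$ (for points for which the denominator is nonzero). Uniformly perfect: $(Z,\rho)$ is $\mu$-uniformly perfect ($\mu\in(0,1)$) if for each $x\in Z$ and $r>0$, $\mathbb{B}(x,r)\setminus\mathbb{B}(x,\mu r)\ne\emptyset$ whenever $Z\setminus\mathbb{B}(x,r)\neq\emptyset$.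 HD (homogeneously dense): $(Z,\rho)$ is $(\lambda_1,\lambda_2)$-HD, with $0<\lambda_1\le\lambda_2<1$, if for each pair of points $a,b\in Z$ there is $x\in Z$ with $\lambda_1\rho(a,b)\le\rho(a,x)\le\lambda_2\rho(a,b)$. $\sigma$-dense: for distinct $a,b\in Z$, a chain joining $a$ and $b$ is a sequence $\{x_i\}_{i\in\mathbb{Z}}$ in $Z$ with $a\ne x_i\ne b$ for all $i$, $x_i\to a$ as $i\to-\infty$ and $x_i\to b$ as $i\to+\infty$. It is a $\sigma$-chain ($\sigma>1$) if $|\log r(a,x_i,x_{i+1},b)|\le\log\sigma$ for all $i$. $(Z,\rho)$ is $\sigma$-dense if any pair of distinct points of $Z$ can be joined by a $\sigma$-chain. Quantitative equivalence: a condition $A$ with data $v$ implies a condition $B$ with data $v'$ quantitatively if $A$ implies $B$ with $v'$ depending only on $v$; the conditions are quantitatively equivalent if each implies the other quantitatively. Here the data are the constants named in each condition; the quasi-metric coefficient $K$ of the space is regarded as part of the data.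
   Formalization: Two-point spaces are excluded in (4)⇒(1),(2),(3): there (4) holds vacuously while (1), (2), (3) fail. The dependence of constants on data is stated for spaces inside an arbitrary fixed ambient set; a common constant follows by embedding counterexamples in one large set. *)

theory Defs
  imports Complex_Main
begin

definition quasi_metric_on :: "real \<Rightarrow> 'a set \<Rightarrow> ('a \<Rightarrow> 'a \<Rightarrow> real) \<Rightarrow> bool" where
  "quasi_metric_on K Z \<rho> \<longleftrightarrow>
     K > 1 \<and>
     (\<forall>x\<in>Z. \<forall>y\<in>Z. \<rho> x y \<ge> 0) \<and>
     (\<forall>x\<in>Z. \<forall>y\<in>Z. \<rho> x y = 0 \<longleftrightarrow> x = y) \<and>
     (\<forall>x\<in>Z. \<forall>y\<in>Z. \<rho> x y = \<rho> y x) \<and>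
     (\<forall>x\<in>Z. \<forall>y\<in>Z. \<forall>z\<in>Z. \<rho> x z \<le> K * max (\<rho> x y) (\<rho> y z))"

definition qball :: "'a set \<Rightarrow> ('a \<Rightarrow> 'a \<Rightarrow> real) \<Rightarrow> 'a \<Rightarrow> real \<Rightarrow> 'a set" where
  "qball Z \<rho> x r = {y \<in> Z. \<rho> x y < r}"

(* Meaningful only if a \<noteq> b and c \<noteq> d; every use below ensures this. *)
definition cross_ratio :: "('a \<Rightarrow> 'a \<Rightarrow> real) \<Rightarrow> 'a \<Rightarrow> 'a \<Rightarrow> 'a \<Rightarrow> 'a \<Rightarrow> real" where
  "cross_ratio \<rho> a b c d = (\<rho> a c * \<rho> b d) / (\<rho> a b * \<rho> c d)"

(* In each of the four conditions the admissible range of the constants is part of the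
   predicate, so that producing new constants includes producing admissible ones. *)

definition uniformly_perfect :: "real \<Rightarrow> 'a set \<Rightarrow> ('a \<Rightarrow> 'a \<Rightarrow> real) \<Rightarrow> bool" where
  "uniformly_perfect \<mu> Z \<rho> \<longleftrightarrow>
     0 < \<mu> \<and> \<mu> < 1 \<and>
     (\<forall>x\<in>Z. \<forall>r>0. Z - qball Z \<rho> x r \<noteq> {} \<longrightarrow>
        qball Z \<rho> x r - qball Z \<rho> x (\<mu> * r) \<noteq> {})"

definition homogeneously_dense ::
    "real \<Rightarrow> real \<Rightarrow> 'a set \<Rightarrow> ('a \<Rightarrow> 'a \<Rightarrow> real) \<Rightarrow> bool" where
  "homogeneously_dense l1 l2 Z \<rho> \<longleftrightarrow>
     0 < l1 \<and> l1 \<le> l2 \<and> l2 < 1 \<and>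
     (\<forall>a\<in>Z. \<forall>b\<in>Z. \<exists>x\<in>Z. l1 * \<rho> a b \<le> \<rho> a x \<and> \<rho> a x \<le> l2 * \<rho> a b)"

definition is_chain ::
    "'a set \<Rightarrow> ('a \<Rightarrow> 'a \<Rightarrow> real) \<Rightarrow> 'a \<Rightarrow> 'a \<Rightarrow> (int \<Rightarrow> 'a) \<Rightarrow> bool" where
  "is_chain Z \<rho> a b x \<longleftrightarrow>
     (\<forall>i. x i \<in> Z \<and> x i \<noteq> a \<and> x i \<noteq> b) \<and>
     ((\<lambda>i. \<rho> (x i) a) \<longlongrightarrow> 0) at_bot \<and>
     ((\<lambda>i. \<rho> (x i) b) \<longlongrightarrow> 0) at_top"

definition is_sigma_chain ::
    "real \<Rightarrow> 'a set \<Rightarrow> ('a \<Rightarrow> 'a \<Rightarrow> real) \<Rightarrow> 'a \<Rightarrow> 'a \<Rightarrow> (int \<Rightarrow> 'a) \<Rightarrow> bool" where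
  "is_sigma_chain \<sigma> Z \<rho> a b x \<longleftrightarrow>
     is_chain Z \<rho> a b x \<and>
     (\<forall>i. \<bar>ln (cross_ratio \<rho> a (x i) (x (i + 1)) b)\<bar> \<le> ln \<sigma>)"

definition sigma_dense :: "real \<Rightarrow> 'a set \<Rightarrow> ('a \<Rightarrow> 'a \<Rightarrow> real) \<Rightarrow> bool" where
  "sigma_dense \<sigma> Z \<rho> \<longleftrightarrow>
     \<sigma> > 1 \<and>
     (\<forall>a\<in>Z. \<forall>b\<in>Z. a \<noteq> b \<longrightarrow> (\<exists>x. is_sigma_chain \<sigma> Z \<rho> a b x))"

definition cross_ratio_dense ::
    "real \<Rightarrow> real \<Rightarrow> 'a set \<Rightarrow> ('a \<Rightarrow> 'a \<Rightarrow> real) \<Rightarrow> bool" where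
  "cross_ratio_dense \<mu>1 \<mu>2 Z \<rho> \<longleftrightarrow>
     0 < \<mu>1 \<and> \<mu>1 \<le> \<mu>2 \<and> \<mu>2 < 1 \<and>
     (\<forall>a\<in>Z. \<forall>c\<in>Z. \<forall>d\<in>Z. a \<noteq> c \<longrightarrow> a \<noteq> d \<longrightarrow> c \<noteq> d \<longrightarrow>
        (\<exists>x\<in>Z - {a}. \<mu>1 \<le> cross_ratio \<rho> a x c d \<and> cross_ratio \<rho> a x c d \<le> \<mu>2))"

(* S K Z \<rho> describes a class of spaces with coefficient K.  The function f turning the data
   v of A into data of B sees only K and v; it is chosen before, and hence is independent
   of, the space (Z, \<rho>). *)
definition quantitatively_implies ::
    "(real \<Rightarrow> 'a set \<Rightarrow> ('a \<Rightarrow> 'a \<Rightarrow> real) \<Rightarrow> bool) \<Rightarrow>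
     ('v \<Rightarrow> 'a set \<Rightarrow> ('a \<Rightarrow> 'a \<Rightarrow> real) \<Rightarrow> bool) \<Rightarrow>
     ('w \<Rightarrow> 'a set \<Rightarrow> ('a \<Rightarrow> 'a \<Rightarrow> real) \<Rightarrow> bool) \<Rightarrow> bool" where
  "quantitatively_implies S A B \<longleftrightarrow>
     (\<exists>f :: real \<Rightarrow> 'v \<Rightarrow> 'w. \<forall>K v Z \<rho>. S K Z \<rho> \<longrightarrow> A v Z \<rho> \<longrightarrow> B (f K v) Z \<rho>)"

definition quantitatively_equivalent ::
    "(real \<Rightarrow> 'a set \<Rightarrow> ('a \<Rightarrow> 'a \<Rightarrow> real) \<Rightarrow> bool) \<Rightarrow>
     ('v \<Rightarrow> 'a set \<Rightarrow> ('a \<Rightarrow> 'a \<Rightarrow> real) \<Rightarrow> bool) \<Rightarrow>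
     ('w \<Rightarrow> 'a set \<Rightarrow> ('a \<Rightarrow> 'a \<Rightarrow> real) \<Rightarrow> bool) \<Rightarrow> bool" where
  "quantitatively_equivalent S A B \<longleftrightarrow>
     quantitatively_implies S A B \<and> quantitatively_implies S B A"

(* A two-point space has no triple of distinct points, so it is vacuously cross_ratio_dense,
   yet it satisfies none of the other three conditions.  Implications starting from
   cross_ratio_dense therefore have to exclude it.  (card Z \<noteq> 2 keeps infinite Z.) *)
lemma two_point_exception:
  assumes "quasi_metric_on K Z \<rho>" and "card Z = 2"
  shows "0 < \<mu>1 \<Longrightarrow> \<mu>1 \<le> \<mu>2 \<Longrightarrow> \<mu>2 < 1 \<Longrightarrow> cross_ratio_dense \<mu>1 \<mu>2 Z \<rho>"
    and "\<not> uniformly_perfect \<mu> Z \<rho>"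
    and "\<not> homogeneously_dense l1 l2 Z \<rho>"
    and "\<not> sigma_dense \<sigma> Z \<rho>"
proof -
  obtain p q where Z: "Z = {p, q}" and pq: "p \<noteq> q"
    using assms(2) by (auto simp: card_2_iff)
  have pZ: "p \<in> Z" and qZ: "q \<in> Z"
    by (simp_all add: Z)
  have "\<forall>x\<in>Z. \<forall>y\<in>Z. \<rho> x y \<ge> 0" and eq0: "\<forall>x\<in>Z. \<forall>y\<in>Z. \<rho> x y = 0 \<longleftrightarrow> x = y"
    using assms(1) unfolding quasi_metric_on_def by fast+
  then have "\<rho> p q \<ge> 0" and "\<rho> p q \<noteq> 0" and 0: "\<rho> p p = 0"
    using pZ qZ pq by blast+
  then have pos: "\<rho> p q > 0"
    by linarith
  show "cross_ratio_dense \<mu>1 \<mu>2 Z \<rho>" if "0 < \<mu>1" "\<mu>1 \<le> \<mu>2" "\<mu>2 < 1"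
    using that unfolding cross_ratio_dense_def Z by auto
  show "\<not> uniformly_perfect \<mu> Z \<rho>"
  proof
    assume up: "uniformly_perfect \<mu> Z \<rho>"
    from up have "0 < \<mu>"
      by (simp add: uniformly_perfect_def)
    moreover from up pZ pos have "Z - qball Z \<rho> p (\<rho> p q) \<noteq> {} \<longrightarrow>
        qball Z \<rho> p (\<rho> p q) - qball Z \<rho> p (\<mu> * \<rho> p q) \<noteq> {}"
      unfolding uniformly_perfect_def by metis
    ultimately show False
      using pos 0 by (auto simp: qball_def Z)
  qed
  show "\<not> homogeneously_dense l1 l2 Z \<rho>"
  proof
    assume hd: "homogeneously_dense l1 l2 Z \<rho>"
    from hd have l: "0 < l1" "l2 < 1"
      by (simp_all add: homogeneously_dense_def)
    from hd pZ qZ have "\<exists>x\<in>Z. l1 * \<rho> p q \<le> \<rho> p x \<and> \<rho> p x \<le> l2 * \<rho> p q"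
      unfolding homogeneously_dense_def by metis
    then have "l1 * \<rho> p q \<le> 0 \<or> \<rho> p q \<le> l2 * \<rho> p q"
      using 0 by (auto simp: Z)
    moreover have "0 < l1 * \<rho> p q" and "l2 * \<rho> p q < \<rho> p q"
      using l pos by auto
    ultimately show False by linarith
  qed
  show "\<not> sigma_dense \<sigma> Z \<rho>"
  proof
    assume "sigma_dense \<sigma> Z \<rho>"
    then obtain x where "is_sigma_chain \<sigma> Z \<rho> p q x"
      using pq unfolding sigma_dense_def by (auto simp: Z)
    then have "x 0 \<in> Z" "x 0 \<noteq> p" "x 0 \<noteq> q"
      unfolding is_sigma_chain_def is_chain_def by simp_all
    then show False
      by (simp add: Z)
  qed
qed

end

theory Submission
  imports Defs
begin

text \<open>
  Fix distinct points \<open>a\<close>, \<open>b\<close> and consider the ratio \<open>A(x) = \<rho>(a,x) / \<rho>(x,b)\<close>, whose level sets are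
  the Apollonian spheres with foci \<open>a\<close> and \<open>b\<close>. It grows from \<open>0\<close> at \<open>a\<close> to infinity at \<open>b\<close>, and both
  cross ratios that occur are quotients of its values: \<open>r(a,x,y,b) = A(y) / A(x)\<close>. The proof compares
  the conditions with one intermediate property, called \<open>apollonian_dense\<close> below: for all foci, the
  values of \<open>A\<close> meet every interval \<open>[T/C, T]\<close> with \<open>T > 0\<close>.

  \<^item> Near \<open>a\<close> the distance \<open>\<rho>(x,b)\<close> is \<open>\<rho>(a,b)\<close> up to the factor \<open>K\<close>, so an annulus around \<open>a\<close> is an
    interval of values of \<open>A\<close> up to constants, and by exchanging the foci the same holds near \<open>b\<close>.
    Hence uniform perfectness, which says that annuli are nonempty, is the property
    \<open>apollonian_dense\<close>.
  \<^item> In a \<open>\<sigma>\<close>-chain the value of \<open>A\<close> changes by a factor of at most \<open>\<sigma>\<close> in each step and runs from \<open>0\<close>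
    to infinity, so it cannot jump over an interval \<open>[T/\<sigma>, T]\<close>. Conversely, points chosen in the
    windows \<open>[C^(i-1), C^i]\<close> form a chain.
  \<^item> The condition on triples says that the value of \<open>A\<close> at any given point can be multiplied by a
    factor in \<open>[\<mu>1, \<mu>2]\<close>. Iteration produces arbitrarily small values without jumping over windows,
    and arbitrarily large ones after the foci have been exchanged. The iteration needs a point other
    than the foci to start from, which is why two-point spaces are excluded there.
  \<^item> Homogeneous density is the same step condition for the distance from \<open>a\<close>, so its equivalence
    with uniform perfectness follows by the same iteration.
\<close>

section \<open>Windows hit by iterated steps\<close>

text \<open>
  The iterates of the step tend to \<open>0\<close>. The first one below \<open>T\<close> comes from a value that is at least
  \<open>T\<close>, hence is at least \<open>l1 * T\<close>.
\<close>

lemma shrinking_steps_hit_window: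
  fixes S :: "real set"
  assumes l1: "0 < l1" and l2: "l2 < 1"
    and pos: "\<And>s. s \<in> S \<Longrightarrow> 0 < s"
    and step: "\<And>s. s \<in> S \<Longrightarrow> \<exists>s'\<in>S. l1 * s \<le> s' \<and> s' \<le> l2 * s"
    and s0: "s0 \<in> S" "T \<le> s0" and T: "0 < T"
  shows "\<exists>s\<in>S. l1 * T \<le> s \<and> s < T"
proof -
  obtain g where g: "\<And>s. s \<in> S \<Longrightarrow> g s \<in> S \<and> l1 * s \<le> g s \<and> g s \<le> l2 * s"
    using step by metis
  define f where "f n = (g ^^ n) s0" for n
  have f0: "f 0 = s0" by (simp add: f_def)
  have fS: "f n \<in> S" for n
    by (induction n) (use s0(1) g in \<open>auto simp: f_def\<close>)
  have fl: "l1 * f n \<le> f (Suc n)" and fu: "f (Suc n) \<le> l2 * f n" for n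
    using g[OF fS[of n]] by (simp_all add: f_def)
  have "0 < l2 * s0"
    using fu[of 0] pos[OF fS[of 1]] f0 by simp
  then have l2_pos: "0 < l2"
    using pos[OF s0(1)] by (simp add: zero_less_mult_iff)
  have decay: "f n \<le> l2 ^ n * s0" for n
  proof (induction n)
    case (Suc n)
    have "f (Suc n) \<le> l2 * f n" by (rule fu)
    also have "\<dots> \<le> l2 * (l2 ^ n * s0)"
      using Suc l2_pos by (intro mult_left_mono) auto
    finally show ?case by (simp add: mult.assoc)
  qed (simp add: f0)
  obtain n where n: "l2 ^ n < T / s0"
    using real_arch_pow_inv[of "T / s0" l2] l2 T pos[OF s0(1)] by auto
  have "f n < T"
    using decay[of n] n pos[OF s0(1)] by (simp add: pos_less_divide_eq)
  then obtain m where m: "f m < T" and below: "\<And>k. k < m \<Longrightarrow> \<not> f k < T"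
    using exists_least_iff[of "\<lambda>k. f k < T"] by blast
  have "m \<noteq> 0"
    using m f0 s0(2) by (metis not_le)
  then obtain k where k: "m = Suc k"
    using not0_implies_Suc by blast
  have "l1 * T \<le> l1 * f k"
    using below[of k] k l1 by (intro mult_left_mono) auto
  also have "\<dots> \<le> f m"
    using fl k by simp
  finally show ?thesis
    using m fS by blast
qed

lemma int_last_before_change:
  fixes P :: "int \<Rightarrow> bool"
  assumes "P m" "\<not> P n" "m \<le> n"
  shows "\<exists>i. P i \<and> \<not> P (i + 1)"
proof (rule ccontr)
  assume "\<not> ?thesis"
  then have "P i \<Longrightarrow> P (i + 1)" for i by blast
  with \<open>m \<le> n\<close> \<open>P m\<close> have "P n"
    by (induction n rule: int_ge_induct) auto
  then show False using assms(2) by contradiction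
qed

section \<open>The Apollonian ratio\<close>

definition apollonian_ratio :: "('a \<Rightarrow> 'a \<Rightarrow> real) \<Rightarrow> 'a \<Rightarrow> 'a \<Rightarrow> 'a \<Rightarrow> real" where
  "apollonian_ratio \<rho> a b x = \<rho> a x / \<rho> x b"

definition apollonian_dense :: "real \<Rightarrow> 'a set \<Rightarrow> ('a \<Rightarrow> 'a \<Rightarrow> real) \<Rightarrow> bool" where
  "apollonian_dense C Z \<rho> \<longleftrightarrow>
     C > 1 \<and>
     (\<forall>a\<in>Z. \<forall>b\<in>Z. a \<noteq> b \<longrightarrow> (\<forall>T>0. \<exists>x\<in>Z - {a, b}.
        T / C \<le> apollonian_ratio \<rho> a b x \<and> apollonian_ratio \<rho> a b x \<le> T))"

lemma cross_ratio_eq_apollonian_quotient: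
  "cross_ratio \<rho> a x y b = apollonian_ratio \<rho> a b y / apollonian_ratio \<rho> a b x"
  by (simp add: cross_ratio_def apollonian_ratio_def)

locale quasi_metric =
  fixes K :: real and Z :: "'a set" and \<rho> :: "'a \<Rightarrow> 'a \<Rightarrow> real"
  assumes quasi_metric_on: "quasi_metric_on K Z \<rho>"
begin

lemma K_gt_1: "1 < K"
  and qdist_eq_0_iff: "\<lbrakk>x \<in> Z; y \<in> Z\<rbrakk> \<Longrightarrow> \<rho> x y = 0 \<longleftrightarrow> x = y"
  and qdist_commute: "\<lbrakk>x \<in> Z; y \<in> Z\<rbrakk> \<Longrightarrow> \<rho> x y = \<rho> y x"
  and dist_quasi_ultra: "\<lbrakk>x \<in> Z; y \<in> Z; z \<in> Z\<rbrakk> \<Longrightarrow> \<rho> x z \<le> K * max (\<rho> x y) (\<rho> y z)"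
  using quasi_metric_on unfolding quasi_metric_on_def by metis+

lemma dist_pos: "\<lbrakk>x \<in> Z; y \<in> Z; x \<noteq> y\<rbrakk> \<Longrightarrow> 0 < \<rho> x y"
  using quasi_metric_on unfolding quasi_metric_on_def by (metis order_le_less)

lemma ratio_pos: "\<lbrakk>a \<in> Z; b \<in> Z; x \<in> Z - {a, b}\<rbrakk> \<Longrightarrow> 0 < apollonian_ratio \<rho> a b x"
  unfolding apollonian_ratio_def by (intro divide_pos_pos dist_pos) auto

lemma ratio_swap_foci:
  "\<lbrakk>a \<in> Z; b \<in> Z; x \<in> Z\<rbrakk> \<Longrightarrow> apollonian_ratio \<rho> b a x = inverse (apollonian_ratio \<rho> a b x)"
  unfolding apollonian_ratio_def using qdist_commute by (simp add: field_simps)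

lemma far_from_second_focus:
  assumes "a \<in> Z" "b \<in> Z" "x \<in> Z" "\<rho> a x < \<rho> a b / K"
  shows "\<rho> a b / K \<le> \<rho> x b"
proof -
  have "\<rho> a b / K \<le> max (\<rho> a x) (\<rho> x b)"
    using dist_quasi_ultra[of a x b] assms K_gt_1 by (simp add: pos_divide_le_eq mult.commute)
  then show ?thesis using assms(4) by linarith
qed

text \<open>Near \<open>a\<close> the ratio is the distance from \<open>a\<close> in units of \<open>\<rho> a b\<close>, up to the factor \<open>K\<close>.\<close>

lemma ratio_bounds_near_first_focus:
  assumes ab: "a \<in> Z" "b \<in> Z" "a \<noteq> b" and x: "x \<in> Z" and near: "\<rho> a x < \<rho> a b / K"
  shows "\<rho> a x / (K * \<rho> a b) \<le> apollonian_ratio \<rho> a b x"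
    and "apollonian_ratio \<rho> a b x \<le> K * \<rho> a x / \<rho> a b"
proof -
  have ab_pos: "0 < \<rho> a b" using dist_pos ab by blast
  have ax_nonneg: "0 \<le> \<rho> a x"
    using dist_pos[OF ab(1) x] qdist_eq_0_iff[OF ab(1) x] by (cases "a = x") auto
  have lower: "\<rho> a b / K \<le> \<rho> x b"
    by (rule far_from_second_focus) fact+
  have "\<rho> a b / K \<le> \<rho> a b"
    using K_gt_1 ab_pos by (simp add: pos_divide_le_eq)
  then have "max (\<rho> x a) (\<rho> a b) \<le> \<rho> a b"
    using near qdist_commute[OF ab(1) x] by auto
  then have "K * max (\<rho> x a) (\<rho> a b) \<le> K * \<rho> a b"
    using K_gt_1 by (intro mult_left_mono) auto
  then have upper: "\<rho> x b \<le> K * \<rho> a b"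
    using dist_quasi_ultra[OF x ab(1,2)] by linarith
  have far_pos: "0 < \<rho> a b / K" using ab_pos K_gt_1 by simp
  have xb_pos: "0 < \<rho> x b" using far_pos lower by linarith
  show "\<rho> a x / (K * \<rho> a b) \<le> apollonian_ratio \<rho> a b x"
    unfolding apollonian_ratio_def
    using upper ax_nonneg xb_pos ab_pos K_gt_1 by (intro divide_left_mono mult_pos_pos) auto
  have "\<rho> a x / \<rho> x b \<le> \<rho> a x / (\<rho> a b / K)"
    using lower ax_nonneg far_pos xb_pos by (intro divide_left_mono mult_pos_pos) auto
  then show "apollonian_ratio \<rho> a b x \<le> K * \<rho> a x / \<rho> a b"
    unfolding apollonian_ratio_def by (simp add: mult.commute)
qed

text \<open>
  A ratio below \<open>1 / K\<close> forces \<open>x\<close> to be close to \<open>a\<close>: since \<open>\<rho> x b \<le> K * max (\<rho> a x) (\<rho> a b)\<close>, the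
  alternative \<open>\<rho> a x > \<rho> a b\<close> would make the ratio at least \<open>1 / K\<close>.
\<close>

lemma dist_le_of_small_ratio:
  assumes ab: "a \<in> Z" "b \<in> Z" and x: "x \<in> Z - {a, b}"
    and t: "apollonian_ratio \<rho> a b x \<le> t" "t * K < 1"
  shows "\<rho> a x \<le> t * K * \<rho> a b"
proof -
  have xb: "0 < \<rho> x b" and ax: "0 < \<rho> a x" using dist_pos ab x by auto
  have t_pos: "0 < t" using ratio_pos[OF ab x] t(1) by linarith
  have "\<rho> a x \<le> t * \<rho> x b"
    using t(1) xb unfolding apollonian_ratio_def by (simp add: pos_divide_le_eq)
  also have "\<dots> \<le> t * (K * max (\<rho> a x) (\<rho> a b))"
    using dist_quasi_ultra[of x a b] qdist_commute[of a x] ab x t_pos by auto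
  finally have le: "\<rho> a x \<le> t * K * max (\<rho> a x) (\<rho> a b)" by (simp add: mult.assoc)
  have "t * K * \<rho> a x < \<rho> a x" using t(2) ax by simp
  then show ?thesis using le by (auto simp: max_def split: if_splits)
qed

lemma dist_ge_of_ratio_ge:
  assumes ab: "a \<in> Z" "b \<in> Z" "a \<noteq> b" and x: "x \<in> Z - {a, b}"
    and t: "t \<le> apollonian_ratio \<rho> a b x" "0 \<le> t" "t \<le> 1"
  shows "t * \<rho> a b / K \<le> \<rho> a x"
proof (cases "\<rho> a x < \<rho> a b / K")
  case True
  have xb: "0 < \<rho> x b" using dist_pos ab x by auto
  have "t * (\<rho> a b / K) \<le> t * \<rho> x b"
    using far_from_second_focus[of a b x] True ab x t(2) by (intro mult_left_mono) auto
  also have "\<dots> \<le> \<rho> a x"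
    using t(1) xb unfolding apollonian_ratio_def by (simp add: pos_le_divide_eq)
  finally show ?thesis by simp
next
  case False
  have "t * (\<rho> a b / K) \<le> 1 * (\<rho> a b / K)"
    using t(3) dist_pos[OF ab] K_gt_1 by (intro mult_right_mono) auto
  then show ?thesis using False by simp
qed

section \<open>Uniform perfectness and Apollonian density\<close>

lemma uniformly_perfect_small_window:
  assumes up: "uniformly_perfect \<mu> Z \<rho>" and ab: "a \<in> Z" "b \<in> Z" "a \<noteq> b" and T: "0 < T" "T \<le> 1"
  shows "\<exists>x\<in>Z - {a, b}. T / (K\<^sup>2 / \<mu>) \<le> apollonian_ratio \<rho> a b x \<and> apollonian_ratio \<rho> a b x \<le> T"
proof -
  have mu: "0 < \<mu>" using up by (simp add: uniformly_perfect_def)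
  have ab_pos: "0 < \<rho> a b" using dist_pos ab by blast
  define r where "r = T * \<rho> a b / K"
  have r: "0 < r" "r \<le> \<rho> a b / K" "r \<le> \<rho> a b"
  proof -
    show "0 < r" unfolding r_def using T ab_pos K_gt_1 by simp
    show "r \<le> \<rho> a b / K"
      unfolding r_def using T ab_pos K_gt_1 by (intro divide_right_mono) auto
    also have "\<dots> \<le> \<rho> a b" using K_gt_1 ab_pos by (simp add: pos_divide_le_eq)
    finally show "r \<le> \<rho> a b" .
  qed
  have "b \<in> Z - qball Z \<rho> a r" using ab r(3) by (simp add: qball_def)
  then obtain x where x: "x \<in> Z" "\<mu> * r \<le> \<rho> a x" "\<rho> a x < r"
    using up ab(1) r(1) unfolding uniformly_perfect_def qball_def by fastforce
  have near: "\<rho> a x < \<rho> a b / K" using x(3) r(2) by linarith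
  have "x \<noteq> a"
    using x(2) mult_pos_pos[OF mu r(1)] qdist_eq_0_iff[OF ab(1) ab(1)] by auto
  moreover have "x \<noteq> b" using x(3) r(3) by auto
  moreover have "T / (K\<^sup>2 / \<mu>) = \<mu> * r / (K * \<rho> a b)"
    unfolding r_def using ab_pos K_gt_1 mu by (simp add: field_simps power2_eq_square)
  moreover have "\<mu> * r / (K * \<rho> a b) \<le> \<rho> a x / (K * \<rho> a b)"
    using x(2) ab_pos K_gt_1 by (intro divide_right_mono) auto
  moreover have "K * \<rho> a x / \<rho> a b \<le> K * r / \<rho> a b"
    using x(3) ab_pos K_gt_1 by (intro divide_right_mono mult_left_mono) auto
  moreover have "K * r / \<rho> a b = T"
    unfolding r_def using ab_pos K_gt_1 by simp
  ultimately show ?thesis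
    using ratio_bounds_near_first_focus[OF ab x(1) near] x(1) by (intro bexI[of _ x]) auto
qed

text \<open>
  With \<open>M = K\<^sup>2 / \<mu>\<close>, the annuli around \<open>a\<close> provide the windows \<open>[T / M, T]\<close> with \<open>T \<le> 1\<close> and those
  around \<open>b\<close> the windows \<open>[T, M * T]\<close> with \<open>T \<ge> 1\<close>. Every window of the larger quotient \<open>M\<^sup>2\<close> contains
  one of these.
\<close>

lemma uniformly_perfect_imp_apollonian_dense:
  assumes up: "uniformly_perfect \<mu> Z \<rho>"
  shows "apollonian_dense (K^4 / \<mu>\<^sup>2) Z \<rho>"
proof -
  have mu: "0 < \<mu>" "\<mu> < 1" using up by (simp_all add: uniformly_perfect_def)
  define M where "M = K\<^sup>2 / \<mu>"
  have "1 < K\<^sup>2" using K_gt_1 by simp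
  then have M: "1 < M" using mu by (simp add: M_def pos_less_divide_eq)
  have C: "K^4 / \<mu>\<^sup>2 = M * M" by (simp add: M_def power2_eq_square power4_eq_xxxx)
  have "1 < M * M" using M less_1_mult by blast
  moreover have "\<exists>x\<in>Z - {a, b}. T / (M * M) \<le> apollonian_ratio \<rho> a b x \<and> apollonian_ratio \<rho> a b x \<le> T"
    if ab: "a \<in> Z" "b \<in> Z" "a \<noteq> b" and T: "0 < T" for a b T
  proof (cases "T \<le> M")
    case True
    obtain x where x: "x \<in> Z - {a, b}" "T / M / M \<le> apollonian_ratio \<rho> a b x"
        "apollonian_ratio \<rho> a b x \<le> T / M"
      using uniformly_perfect_small_window[OF up ab, of "T / M"] True T M
      unfolding M_def[symmetric] by auto
    have "T / M \<le> T" using M T by (simp add: pos_divide_le_eq)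
    then show ?thesis using x by (intro bexI[of _ x]) (auto simp: divide_divide_eq_left)
  next
    case False
    obtain x where x: "x \<in> Z - {b, a}" "M / T / M \<le> apollonian_ratio \<rho> b a x"
        "apollonian_ratio \<rho> b a x \<le> M / T"
      using uniformly_perfect_small_window[OF up ab(2,1) ab(3)[symmetric], of "M / T"] False T M
      unfolding M_def[symmetric] by auto
    have x': "x \<in> Z - {a, b}" using x(1) by blast
    define A where "A = apollonian_ratio \<rho> a b x"
    have A: "0 < A" unfolding A_def using ratio_pos ab x' by blast
    have inv: "apollonian_ratio \<rho> b a x = inverse A"
      unfolding A_def using ratio_swap_foci ab x' by blast
    have "A \<le> T"
      using x(2) M T A unfolding inv by (simp add: field_simps)
    moreover have "T / M \<le> A"
      using x(3) M T A unfolding inv by (simp add: field_simps)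
    moreover have "T / (M * M) \<le> T / M"
      using M T by (intro divide_left_mono) auto
    ultimately show ?thesis using x' unfolding A_def by (intro bexI[of _ x]) auto
  qed
  ultimately show ?thesis unfolding apollonian_dense_def C by blast
qed

text \<open>
  For a point \<open>b\<close> at distance at least \<open>r\<close> from \<open>a\<close>, the window ending at \<open>T = r / (2 * K * \<rho> a b)\<close>
  yields a point of the annulus: \<open>T\<close> is chosen such that the upper bound \<open>T * K * \<rho> a b\<close> of
  \<open>dist_le_of_small_ratio\<close> is \<open>r / 2\<close>, hence strictly less than \<open>r\<close>.
\<close>

lemma apollonian_dense_imp_uniformly_perfect:
  assumes ad: "apollonian_dense C Z \<rho>"
  shows "uniformly_perfect (1 / (2 * C * K\<^sup>2)) Z \<rho>"
proof -
  have C: "1 < C" using ad by (simp add: apollonian_dense_def)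
  have "1 < K\<^sup>2" using K_gt_1 by simp
  then have "1 < C * K\<^sup>2" using C less_1_mult by blast
  then have gt: "1 < 2 * C * K\<^sup>2" by linarith
  have "qball Z \<rho> a r - qball Z \<rho> a (1 / (2 * C * K\<^sup>2) * r) \<noteq> {}"
    if a: "a \<in> Z" and r: "0 < r" and b: "b \<in> Z - qball Z \<rho> a r" for a b r
  proof -
    have bZ: "b \<in> Z" and far: "r \<le> \<rho> a b" using b by (auto simp: qball_def)
    have ab: "a \<noteq> b" using far r qdist_eq_0_iff[OF a bZ] by auto
    have ab_pos: "0 < \<rho> a b" using far r by linarith
    define T where "T = r / (2 * K * \<rho> a b)"
    have T: "0 < T" unfolding T_def using r ab_pos K_gt_1 by simp
    have TK: "T * K * \<rho> a b = r / 2" "T * K < 1"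
      unfolding T_def using far r ab_pos K_gt_1 by (simp_all add: field_simps)
    have "T * 1 \<le> T * K" using T K_gt_1 by (intro mult_left_mono) auto
    moreover have "T / C \<le> T / 1" using T C by (intro divide_left_mono) auto
    ultimately have "T / C \<le> 1" using TK(2) by linarith
    moreover have "0 \<le> T / C" using T C by simp
    ultimately have TC: "0 \<le> T / C" "T / C \<le> 1" by simp_all
    obtain x where x: "x \<in> Z - {a, b}" "T / C \<le> apollonian_ratio \<rho> a b x"
        "apollonian_ratio \<rho> a b x \<le> T"
      using ad a bZ ab T unfolding apollonian_dense_def by blast
    have "\<rho> a x \<le> r / 2"
      using dist_le_of_small_ratio[OF a bZ x(1,3) TK(2)] TK(1) by simp
    moreover have "T / C * \<rho> a b / K \<le> \<rho> a x"
      using dist_ge_of_ratio_ge[OF a bZ ab x(1,2) TC] .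
    moreover have "T / C * \<rho> a b / K = 1 / (2 * C * K\<^sup>2) * r"
      unfolding T_def using ab_pos K_gt_1 C by (simp add: field_simps power2_eq_square)
    ultimately have "x \<in> qball Z \<rho> a r - qball Z \<rho> a (1 / (2 * C * K\<^sup>2) * r)"
      using x(1) r by (auto simp: qball_def)
    then show ?thesis by blast
  qed
  then show ?thesis
    using gt unfolding uniformly_perfect_def by auto
qed

section \<open>Uniform perfectness and homogeneous density\<close>

lemma uniformly_perfect_imp_homogeneously_dense:
  assumes up: "uniformly_perfect \<mu> Z \<rho>"
  shows "homogeneously_dense (\<mu> / 2) (1 / 2) Z \<rho>"
proof -
  have mu: "0 < \<mu>" "\<mu> < 1" using up by (simp_all add: uniformly_perfect_def)
  have "\<exists>x\<in>Z. \<mu> / 2 * \<rho> a b \<le> \<rho> a x \<and> \<rho> a x \<le> 1 / 2 * \<rho> a b" if ab: "a \<in> Z" "b \<in> Z" for a b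
  proof (cases "a = b")
    case True
    then show ?thesis using ab qdist_eq_0_iff[OF ab] by (intro bexI[of _ b]) auto
  next
    case False
    have ab_pos: "0 < \<rho> a b / 2" using dist_pos ab False by simp
    have "b \<in> Z - qball Z \<rho> a (\<rho> a b / 2)" using ab ab_pos by (simp add: qball_def)
    then have "qball Z \<rho> a (\<rho> a b / 2) - qball Z \<rho> a (\<mu> * (\<rho> a b / 2)) \<noteq> {}"
      using up ab(1) ab_pos unfolding uniformly_perfect_def by blast
    then show ?thesis by (auto simp: qball_def not_less intro!: bexI)
  qed
  then show ?thesis using mu unfolding homogeneously_dense_def by auto
qed

lemma homogeneously_dense_imp_uniformly_perfect:
  assumes hd: "homogeneously_dense l1 l2 Z \<rho>"
  shows "uniformly_perfect l1 Z \<rho>"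
proof -
  have l: "0 < l1" "l1 \<le> l2" "l2 < 1" using hd by (simp_all add: homogeneously_dense_def)
  have "qball Z \<rho> a r - qball Z \<rho> a (l1 * r) \<noteq> {}"
    if a: "a \<in> Z" and r: "0 < r" and b: "b \<in> Z - qball Z \<rho> a r" for a b r
  proof -
    have bZ: "b \<in> Z" and far: "r \<le> \<rho> a b" using b by (auto simp: qball_def)
    define S where "S = \<rho> a ` (Z - {a})"
    have "\<exists>s\<in>S. l1 * r \<le> s \<and> s < r"
    proof (rule shrinking_steps_hit_window)
      show "0 < l1" "l2 < 1" "r \<le> \<rho> a b" "0 < r" by fact+
      show "0 < s" if "s \<in> S" for s
        using that dist_pos[OF a] unfolding S_def by auto
      show "\<exists>s'\<in>S. l1 * s \<le> s' \<and> s' \<le> l2 * s" if s: "s \<in> S" for s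
      proof -
        obtain y where y: "y \<in> Z" "y \<noteq> a" "s = \<rho> a y" using s unfolding S_def by auto
        obtain x where x: "x \<in> Z" "l1 * s \<le> \<rho> a x" "\<rho> a x \<le> l2 * s"
          using hd a y unfolding homogeneously_dense_def by blast
        have "0 < l1 * s" using l y dist_pos[OF a y(1)] by auto
        then have "x \<noteq> a" using x(2) qdist_eq_0_iff[OF a a] by auto
        then show ?thesis using x unfolding S_def by auto
      qed
      show "\<rho> a b \<in> S"
        using bZ far r qdist_eq_0_iff[OF a a] unfolding S_def by auto
    qed
    then show ?thesis by (fastforce simp: S_def qball_def)
  qed
  then show ?thesis
    using l unfolding uniformly_perfect_def by auto
qed

section \<open>Chains and Apollonian density\<close>

lemma ratio_tendsto_0:
  assumes ab: "a \<in> Z" "b \<in> Z" "a \<noteq> b" and x: "\<And>i. x i \<in> Z - {a, b}"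
    and lim: "((\<lambda>i. \<rho> (x i) a) \<longlongrightarrow> 0) F"
  shows "((\<lambda>i. apollonian_ratio \<rho> a b (x i)) \<longlongrightarrow> 0) F"
proof (rule tendsto_sandwich)
  have xa: "\<rho> (x i) a = \<rho> a (x i)" for i using qdist_commute ab(1) x by blast
  have "0 < \<rho> a b / K" using dist_pos[OF ab] K_gt_1 by simp
  then have "\<forall>\<^sub>F i in F. \<rho> a (x i) < \<rho> a b / K"
    using order_tendstoD(2)[OF lim] by (simp add: xa)
  then show "\<forall>\<^sub>F i in F. apollonian_ratio \<rho> a b (x i) \<le> K * \<rho> (x i) a / \<rho> a b"
    by eventually_elim (use ratio_bounds_near_first_focus(2)[OF ab] x xa in auto)
  show "\<forall>\<^sub>F i in F. 0 \<le> apollonian_ratio \<rho> a b (x i)"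
    using ratio_pos[OF ab(1,2) x] by (intro always_eventually allI less_imp_le)
  show "((\<lambda>i. K * \<rho> (x i) a / \<rho> a b) \<longlongrightarrow> 0) F"
    using tendsto_mult_left[OF lim, of "K / \<rho> a b"] by simp
qed simp

lemma dist_tendsto_0:
  assumes ab: "a \<in> Z" "b \<in> Z" and x: "\<And>i. x i \<in> Z - {a, b}"
    and le: "\<And>i. apollonian_ratio \<rho> a b (x i) \<le> t i" and lim: "(t \<longlongrightarrow> 0) F"
  shows "((\<lambda>i. \<rho> (x i) a) \<longlongrightarrow> 0) F"
proof (rule tendsto_sandwich)
  have xa: "\<rho> (x i) a = \<rho> a (x i)" for i using qdist_commute ab(1) x by blast
  have "((\<lambda>i. t i * K) \<longlongrightarrow> 0) F" using tendsto_mult_right[OF lim, of K] by simp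
  then have "\<forall>\<^sub>F i in F. t i * K < 1" by (rule order_tendstoD) simp
  then show "\<forall>\<^sub>F i in F. \<rho> (x i) a \<le> t i * K * \<rho> a b"
    by eventually_elim (use dist_le_of_small_ratio[OF ab x le] xa in auto)
  have "0 < \<rho> (x i) a" for i using dist_pos ab(1) x by blast
  then show "\<forall>\<^sub>F i in F. 0 \<le> \<rho> (x i) a"
    by (intro always_eventually allI less_imp_le)
  show "((\<lambda>i. t i * K * \<rho> a b) \<longlongrightarrow> 0) F"
    using tendsto_mult_right[OF lim, of "K * \<rho> a b"] by (simp add: mult.assoc)
qed simp

lemma abs_ln_cross_ratio_chain:
  assumes ab: "a \<in> Z" "b \<in> Z" and "x \<in> Z - {a, b}" "y \<in> Z - {a, b}"
  shows "\<bar>ln (cross_ratio \<rho> a x y b)\<bar> =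
    \<bar>ln (apollonian_ratio \<rho> a b y) - ln (apollonian_ratio \<rho> a b x)\<bar>"
  using ratio_pos[OF ab assms(3)] ratio_pos[OF ab assms(4)]
  by (simp add: cross_ratio_eq_apollonian_quotient ln_div)

text \<open>
  Along a chain the ratio runs from \<open>0\<close> to infinity, so it passes \<open>T\<close> at some index, and the step
  bound keeps the last value below \<open>T\<close> above \<open>T / \<sigma>\<close>.
\<close>

lemma sigma_dense_imp_apollonian_dense:
  assumes sd: "sigma_dense \<sigma> Z \<rho>"
  shows "apollonian_dense \<sigma> Z \<rho>"
proof -
  have s: "1 < \<sigma>" using sd by (simp add: sigma_dense_def)
  have "\<exists>x\<in>Z - {a, b}. T / \<sigma> \<le> apollonian_ratio \<rho> a b x \<and> apollonian_ratio \<rho> a b x \<le> T"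
    if ab: "a \<in> Z" "b \<in> Z" "a \<noteq> b" and T: "0 < T" for a b T
  proof -
    obtain x where "is_sigma_chain \<sigma> Z \<rho> a b x"
      using sd ab unfolding sigma_dense_def by blast
    then have xZ: "\<And>i. x i \<in> Z - {a, b}"
      and lim: "((\<lambda>i. \<rho> (x i) a) \<longlongrightarrow> 0) at_bot" "((\<lambda>i. \<rho> (x i) b) \<longlongrightarrow> 0) at_top"
      and step: "\<And>i. \<bar>ln (cross_ratio \<rho> a (x i) (x (i + 1)) b)\<bar> \<le> ln \<sigma>"
      unfolding is_sigma_chain_def is_chain_def by auto
    define A where "A i = apollonian_ratio \<rho> a b (x i)" for i
    have A: "0 < A i" for i unfolding A_def using ratio_pos ab xZ by blast
    have inv: "apollonian_ratio \<rho> b a (x i) = inverse (A i)" for i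
      unfolding A_def using ratio_swap_foci ab xZ by blast
    have xZ': "x i \<in> Z - {b, a}" for i using xZ by blast
    have "(A \<longlongrightarrow> 0) at_bot"
      unfolding A_def using ratio_tendsto_0[OF ab xZ lim(1)] .
    then have "\<forall>\<^sub>F i in at_bot. A i < T" using T by (rule order_tendstoD)
    then obtain m where m: "\<And>i. i \<le> m \<Longrightarrow> A i < T" by (auto simp: eventually_at_bot_linorder)
    have "((\<lambda>i. inverse (A i)) \<longlongrightarrow> 0) at_top"
      using ratio_tendsto_0[OF ab(2,1) ab(3)[symmetric] xZ' lim(2)] unfolding inv .
    then have "\<forall>\<^sub>F i in at_top. inverse (A i) < inverse T" using T by (intro order_tendstoD) auto
    then obtain n where n: "\<And>i. n \<le> i \<Longrightarrow> inverse (A i) < inverse T"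
      by (auto simp: eventually_at_top_linorder)
    have "\<not> A (max m n) < T"
      using n[of "max m n"] A T by (simp add: inverse_less_iff_less)
    then obtain i where i: "A i < T" "\<not> A (i + 1) < T"
      using int_last_before_change[of "\<lambda>i. A i < T" m "max m n"] m[of m] by auto
    have "\<bar>ln (A (i + 1)) - ln (A i)\<bar> \<le> ln \<sigma>"
      unfolding A_def using step[of i] abs_ln_cross_ratio_chain[OF ab(1,2) xZ xZ] by simp
    then have "ln (A (i + 1)) \<le> ln (\<sigma> * A i)"
      using A[of i] s by (simp add: ln_mult)
    then have "A (i + 1) \<le> \<sigma> * A i" using A s by (simp add: ln_le_cancel_iff)
    then have "T / \<sigma> \<le> A i" using i(2) s by (simp add: pos_divide_le_eq mult.commute)
    then show ?thesis using i(1) xZ unfolding A_def by (intro bexI[of _ "x i"]) auto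
  qed
  then show ?thesis using s unfolding apollonian_dense_def by blast
qed

text \<open>
  Points whose ratios lie in the windows \<open>[C^(i-1), C^i]\<close> form a chain. The logarithms of two ratios
  in consecutive windows differ by at most \<open>2 * ln C\<close>.
\<close>

lemma apollonian_dense_imp_sigma_dense:
  assumes ad: "apollonian_dense C Z \<rho>"
  shows "sigma_dense (C\<^sup>2) Z \<rho>"
proof -
  have C: "1 < C" using ad by (simp add: apollonian_dense_def)
  define L where "L = ln C"
  have L: "0 < L" using C by (simp add: L_def)
  have "\<exists>x. is_sigma_chain (C\<^sup>2) Z \<rho> a b x" if ab: "a \<in> Z" "b \<in> Z" "a \<noteq> b" for a b
  proof -
    define T where "T i = exp (L * real_of_int i)" for i
    have T_pos: "0 < T i" for i by (simp add: T_def)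
    have T_div: "T i / C = T (i - 1)" for i
      using C by (simp add: T_def L_def exp_diff right_diff_distrib)
    have "\<exists>x\<in>Z - {a, b}. T i / C \<le> apollonian_ratio \<rho> a b x \<and> apollonian_ratio \<rho> a b x \<le> T i" for i
      using ad ab T_pos unfolding apollonian_dense_def by blast
    then obtain x where xZ: "\<And>i. x i \<in> Z - {a, b}"
      and lower: "\<And>i. T (i - 1) \<le> apollonian_ratio \<rho> a b (x i)"
      and upper: "\<And>i. apollonian_ratio \<rho> a b (x i) \<le> T i"
      unfolding T_div by metis
    have xZ': "x i \<in> Z - {b, a}" for i using xZ by blast
    have A: "0 < apollonian_ratio \<rho> a b (x i)" for i using ratio_pos ab xZ by blast
    have bot: "(T \<longlongrightarrow> 0) at_bot"
    proof -
      have "filterlim real_of_int at_bot at_bot"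
        by (rule filterlim_at_bot[THEN iffD2]) (metis eventually_at_bot_linorder le_floor_iff)
      then have "filterlim (\<lambda>i. L * real_of_int i) at_bot at_bot"
        by (rule filterlim_tendsto_pos_mult_at_bot[OF tendsto_const L])
      then show ?thesis unfolding T_def by (rule filterlim_compose[OF exp_at_bot])
    qed
    have top: "((\<lambda>i. T (1 - i)) \<longlongrightarrow> 0) at_top"
    proof (rule filterlim_compose[OF bot])
      show "filterlim (\<lambda>i::int. 1 - i) at_bot at_top"
        unfolding filterlim_at_bot
        by (metis eventually_at_top_linorder diff_le_eq add.commute le_diff_eq)
    qed
    have upper': "apollonian_ratio \<rho> b a (x i) \<le> T (1 - i)" for i
    proof -
      have "apollonian_ratio \<rho> b a (x i) = inverse (apollonian_ratio \<rho> a b (x i))"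
        using ratio_swap_foci ab xZ by blast
      also have "\<dots> \<le> inverse (T (i - 1))"
        using lower T_pos by (intro le_imp_inverse_le) auto
      also have "\<dots> = T (1 - i)"
        by (simp add: T_def exp_minus[symmetric] algebra_simps)
      finally show ?thesis .
    qed
    have "\<bar>ln (cross_ratio \<rho> a (x i) (x (i + 1)) b)\<bar> \<le> ln (C\<^sup>2)" for i
    proof -
      have ln_bounds: "L * (real_of_int j - 1) \<le> ln (apollonian_ratio \<rho> a b (x j))"
          "ln (apollonian_ratio \<rho> a b (x j)) \<le> L * real_of_int j" for j
        using lower[of j] upper[of j] A[of j]
        by (simp_all add: T_def ln_ge_iff exp_le_cancel_iff[symmetric, of "ln _"])
      have "ln (C\<^sup>2) = 2 * L" using C by (simp add: L_def ln_realpow)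
      then show ?thesis
        using ln_bounds[of i] ln_bounds[of "i + 1"] L abs_ln_cross_ratio_chain[OF ab(1,2) xZ xZ]
        by (simp add: algebra_simps abs_le_iff)
    qed
    then have "is_sigma_chain (C\<^sup>2) Z \<rho> a b x"
      using xZ dist_tendsto_0[OF ab(1,2) xZ upper bot] dist_tendsto_0[OF ab(2,1) xZ' upper' top]
      unfolding is_sigma_chain_def is_chain_def by blast
    then show ?thesis by blast
  qed
  moreover have "1 < C\<^sup>2" using C by simp
  ultimately show ?thesis unfolding sigma_dense_def by blast
qed

section \<open>Cross ratios of triples and Apollonian density\<close>

text \<open>
  With the foci in the order \<open>d\<close>, \<open>a\<close>, a cross ratio below \<open>1\<close> means that passing from \<open>c\<close> to \<open>x\<close>
  decreases the ratio, so the condition on triples has the form of a shrinking step.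
\<close>

lemma cross_ratio_eq_swapped_quotient:
  assumes "a \<in> Z" "d \<in> Z" "c \<in> Z - {a, d}" "x \<in> Z"
  shows "cross_ratio \<rho> a x c d = apollonian_ratio \<rho> d a x / apollonian_ratio \<rho> d a c"
  using assms ratio_swap_foci[of a d]
  by (simp add: cross_ratio_eq_apollonian_quotient divide_inverse)

lemma apollonian_dense_imp_cross_ratio_dense:
  assumes ad: "apollonian_dense C Z \<rho>"
  shows "cross_ratio_dense (1 / (2 * C)) (1 / 2) Z \<rho>"
proof -
  have C: "1 < C" using ad by (simp add: apollonian_dense_def)
  have "\<exists>x\<in>Z - {a}. 1 / (2 * C) \<le> cross_ratio \<rho> a x c d \<and> cross_ratio \<rho> a x c d \<le> 1 / 2"
    if Z: "a \<in> Z" "c \<in> Z" "d \<in> Z" and ne: "a \<noteq> c" "a \<noteq> d" "c \<noteq> d" for a c d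
  proof -
    have c: "c \<in> Z - {a, d}" "c \<in> Z - {d, a}" using Z ne by auto
    define R where "R = apollonian_ratio \<rho> d a c"
    have R: "0 < R" unfolding R_def using ratio_pos Z c by blast
    then have "0 < R / 2" by simp
    then obtain x where x: "x \<in> Z - {d, a}" "R / 2 / C \<le> apollonian_ratio \<rho> d a x"
        "apollonian_ratio \<rho> d a x \<le> R / 2"
      using ad Z ne unfolding apollonian_dense_def by metis
    have "cross_ratio \<rho> a x c d = apollonian_ratio \<rho> d a x / R"
      unfolding R_def using cross_ratio_eq_swapped_quotient Z c x(1) by blast
    moreover have "1 / (2 * C) \<le> apollonian_ratio \<rho> d a x / R" "apollonian_ratio \<rho> d a x / R \<le> 1 / 2"
      using x(2,3) R C by (simp_all add: field_simps)
    ultimately show ?thesis using x(1) by (intro bexI[of _ x]) auto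
  qed
  then show ?thesis using C unfolding cross_ratio_dense_def by auto
qed

lemma cross_ratio_dense_shrinking_step:
  assumes cr: "cross_ratio_dense \<mu>1 \<mu>2 Z \<rho>" and ab: "a \<in> Z" "b \<in> Z" "a \<noteq> b"
    and s: "s \<in> apollonian_ratio \<rho> a b ` (Z - {a, b})"
  shows "\<exists>s'\<in>apollonian_ratio \<rho> a b ` (Z - {a, b}). \<mu>1 * s \<le> s' \<and> s' \<le> \<mu>2 * s"
proof -
  obtain c where c: "c \<in> Z - {a, b}" "s = apollonian_ratio \<rho> a b c" using s by blast
  have s_pos: "0 < s" using ratio_pos ab c by blast
  have mu1: "0 < \<mu>1" using cr by (simp add: cross_ratio_dense_def)
  obtain x where x: "x \<in> Z - {b}" "\<mu>1 \<le> cross_ratio \<rho> b x c a" "cross_ratio \<rho> b x c a \<le> \<mu>2"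
    using cr ab c unfolding cross_ratio_dense_def by (metis Diff_iff insertCI)
  have cross: "cross_ratio \<rho> b x c a = apollonian_ratio \<rho> a b x / s"
    using cross_ratio_eq_swapped_quotient[of b a c x] ab c x by auto
  have "x \<noteq> a"
    using x(2) mu1 qdist_eq_0_iff[OF ab(1) ab(1)] unfolding cross apollonian_ratio_def by auto
  moreover have "\<mu>1 * s \<le> apollonian_ratio \<rho> a b x" "apollonian_ratio \<rho> a b x \<le> \<mu>2 * s"
    using x(2,3) s_pos unfolding cross by (simp_all add: pos_le_divide_eq pos_divide_le_eq)
  ultimately show ?thesis using x(1) by blast
qed

text \<open>
  Steps can only decrease the ratio, so the window below \<open>T\<close> is reached once some ratio is at least
  \<open>T\<close>. If there were none, all ratios for the exchanged foci would exceed \<open>1 / T\<close>; but these can be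
  decreased as well.
\<close>

lemma cross_ratio_dense_imp_apollonian_dense:
  assumes cr: "cross_ratio_dense \<mu>1 \<mu>2 Z \<rho>" and card: "card Z \<noteq> 2"
  shows "apollonian_dense (1 / \<mu>1) Z \<rho>"
proof -
  have mu: "0 < \<mu>1" "\<mu>1 \<le> \<mu>2" "\<mu>2 < 1" using cr by (simp_all add: cross_ratio_dense_def)
  have "\<exists>x\<in>Z - {a, b}. T / (1 / \<mu>1) \<le> apollonian_ratio \<rho> a b x \<and> apollonian_ratio \<rho> a b x \<le> T"
    if ab: "a \<in> Z" "b \<in> Z" "a \<noteq> b" and T: "0 < T" for a b T
  proof -
    have "Z \<noteq> {a, b}" using card ab(3) by auto
    then obtain e where e: "e \<in> Z - {a, b}" using ab by blast
    have window: "\<exists>s\<in>apollonian_ratio \<rho> p q ` (Z - {p, q}). \<mu>1 * t \<le> s \<and> s < t"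
      if "p \<in> Z" "q \<in> Z" "p \<noteq> q" "0 < t" "x \<in> Z - {p, q}" "t \<le> apollonian_ratio \<rho> p q x" for p q t x
      using ratio_pos that
      by (intro shrinking_steps_hit_window[OF mu(1,3) _ cross_ratio_dense_shrinking_step[OF cr]])
         auto
    have "\<exists>x\<in>Z - {a, b}. T \<le> apollonian_ratio \<rho> a b x"
    proof (rule ccontr)
      assume "\<not> ?thesis"
      then have less: "apollonian_ratio \<rho> a b x < T" if "x \<in> Z - {a, b}" for x
        using that by force
      have more: "inverse T < apollonian_ratio \<rho> b a x" if x: "x \<in> Z - {b, a}" for x
      proof -
        have x': "x \<in> Z - {a, b}" using x by blast
        then show ?thesis
          using less[OF x'] ratio_pos[OF ab(1,2) x'] ratio_swap_foci[OF ab(1,2), of x]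
          by (simp add: less_imp_inverse_less)
      qed
      have "\<exists>s\<in>apollonian_ratio \<rho> b a ` (Z - {b, a}). \<mu>1 * inverse T \<le> s \<and> s < inverse T"
        using window[OF ab(2,1) ab(3)[symmetric], of "inverse T" e] T e more[of e] by auto
      then show False using more by fastforce
    qed
    then obtain x where "x \<in> Z - {a, b}" "T \<le> apollonian_ratio \<rho> a b x" by blast
    then show ?thesis using window[OF ab T] by (fastforce simp: mult.commute)
  qed
  moreover have "1 < 1 / \<mu>1" using mu by simp
  ultimately show ?thesis unfolding apollonian_dense_def by blast
qed

end

section \<open>Quantitative equivalence\<close>

lemma quantitatively_impliesI:
  assumes "\<And>K v Z \<rho>. S K Z \<rho> \<Longrightarrow> A v Z \<rho> \<Longrightarrow> B (f K v) Z \<rho>"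
  shows "quantitatively_implies S A B"
  using assms unfolding quantitatively_implies_def by blast

lemma quantitatively_implies_trans:
  assumes AB: "quantitatively_implies S A B" and BC: "quantitatively_implies S B C"
  shows "quantitatively_implies S A C"
proof -
  obtain f g where "\<And>K v Z \<rho>. S K Z \<rho> \<Longrightarrow> A v Z \<rho> \<Longrightarrow> B (f K v) Z \<rho>"
    and "\<And>K w Z \<rho>. S K Z \<rho> \<Longrightarrow> B w Z \<rho> \<Longrightarrow> C (g K w) Z \<rho>"
    using AB BC unfolding quantitatively_implies_def by blast
  then show ?thesis
    by (intro quantitatively_impliesI[where f = "\<lambda>K v. g K (f K v)"]) blast
qed

lemma quantitatively_implies_subclass:
  assumes "quantitatively_implies S A B" "\<And>K Z \<rho>. S' K Z \<rho> \<Longrightarrow> S K Z \<rho>"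
  shows "quantitatively_implies S' A B"
  using assms unfolding quantitatively_implies_def by blast

theorem theorem1p1:
  shows
    "let QM = (quasi_metric_on :: real \<Rightarrow> 'a set \<Rightarrow> ('a \<Rightarrow> 'a \<Rightarrow> real) \<Rightarrow> bool);
         QM' = (\<lambda>K Z \<rho>. QM K Z \<rho> \<and> card Z \<noteq> 2);
         UP = (\<lambda>\<mu>. uniformly_perfect \<mu>);
         HD = (\<lambda>(l1, l2). homogeneously_dense l1 l2);
         SD = (\<lambda>\<sigma>. sigma_dense \<sigma>);
         CR = (\<lambda>(\<mu>1, \<mu>2). cross_ratio_dense \<mu>1 \<mu>2)
     in quantitatively_equivalent QM UP HD \<and>
        quantitatively_equivalent QM UP SD \<and>
        quantitatively_equivalent QM HD SD \<and>
        quantitatively_implies QM UP CR \<and>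
        quantitatively_implies QM HD CR \<and>
        quantitatively_implies QM SD CR \<and>
        quantitatively_implies QM' CR UP \<and>
        quantitatively_implies QM' CR HD \<and>
        quantitatively_implies QM' CR SD"
proof -
  let ?QM = "quasi_metric_on :: real \<Rightarrow> 'a set \<Rightarrow> ('a \<Rightarrow> 'a \<Rightarrow> real) \<Rightarrow> bool"
  let ?QM' = "\<lambda>K Z (\<rho> :: 'a \<Rightarrow> 'a \<Rightarrow> real). quasi_metric_on K Z \<rho> \<and> card Z \<noteq> 2"
  let ?UP = "\<lambda>\<mu>. uniformly_perfect \<mu> :: 'a set \<Rightarrow> ('a \<Rightarrow> 'a \<Rightarrow> real) \<Rightarrow> bool"
  let ?HD = "\<lambda>(l1, l2). homogeneously_dense l1 l2 :: 'a set \<Rightarrow> ('a \<Rightarrow> 'a \<Rightarrow> real) \<Rightarrow> bool"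
  let ?SD = "\<lambda>\<sigma>. sigma_dense \<sigma> :: 'a set \<Rightarrow> ('a \<Rightarrow> 'a \<Rightarrow> real) \<Rightarrow> bool"
  let ?CR = "\<lambda>(\<mu>1, \<mu>2). cross_ratio_dense \<mu>1 \<mu>2 :: 'a set \<Rightarrow> ('a \<Rightarrow> 'a \<Rightarrow> real) \<Rightarrow> bool"
  let ?AD = "\<lambda>C. apollonian_dense C :: 'a set \<Rightarrow> ('a \<Rightarrow> 'a \<Rightarrow> real) \<Rightarrow> bool"
  note compose = quantitatively_implies_trans
  note intros = quasi_metric.intro
  have UP_HD: "quantitatively_implies ?QM ?UP ?HD"
    by (rule quantitatively_impliesI[where f = "\<lambda>K \<mu>. (\<mu> / 2, 1 / 2)"])
       (unfold prod.case, rule quasi_metric.uniformly_perfect_imp_homogeneously_dense[OF intros])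
  have HD_UP: "quantitatively_implies ?QM ?HD ?UP"
    by (rule quantitatively_impliesI[where f = "\<lambda>K. fst"])
       (auto intro: quasi_metric.homogeneously_dense_imp_uniformly_perfect[OF intros])
  have UP_AD: "quantitatively_implies ?QM ?UP ?AD"
    by (rule quantitatively_impliesI[where f = "\<lambda>K \<mu>. K^4 / \<mu>\<^sup>2"])
       (rule quasi_metric.uniformly_perfect_imp_apollonian_dense[OF intros])
  have AD_UP: "quantitatively_implies ?QM ?AD ?UP"
    by (rule quantitatively_impliesI[where f = "\<lambda>K C. 1 / (2 * C * K\<^sup>2)"])
       (rule quasi_metric.apollonian_dense_imp_uniformly_perfect[OF intros])
  have SD_AD: "quantitatively_implies ?QM ?SD ?AD"
    by (rule quantitatively_impliesI[where f = "\<lambda>K \<sigma>. \<sigma>"])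
       (rule quasi_metric.sigma_dense_imp_apollonian_dense[OF intros])
  have AD_SD: "quantitatively_implies ?QM ?AD ?SD"
    by (rule quantitatively_impliesI[where f = "\<lambda>K C. C\<^sup>2"])
       (rule quasi_metric.apollonian_dense_imp_sigma_dense[OF intros])
  have AD_CR: "quantitatively_implies ?QM ?AD ?CR"
  proof (rule quantitatively_impliesI[where f = "\<lambda>K C. (1 / (2 * C), 1 / 2)"])
    fix K C Z and \<rho> :: "'a \<Rightarrow> 'a \<Rightarrow> real"
    assume "quasi_metric_on K Z \<rho>" "apollonian_dense C Z \<rho>"
    then show "?CR (1 / (2 * C), 1 / 2) Z \<rho>"
      using quasi_metric.apollonian_dense_imp_cross_ratio_dense[OF intros] by fastforce
  qed
  have CR_AD: "quantitatively_implies ?QM' ?CR ?AD"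
  proof (rule quantitatively_impliesI[where f = "\<lambda>K v. 1 / fst v"])
    fix K v Z and \<rho> :: "'a \<Rightarrow> 'a \<Rightarrow> real"
    assume "quasi_metric_on K Z \<rho> \<and> card Z \<noteq> 2" "?CR v Z \<rho>"
    then show "apollonian_dense (1 / fst v) Z \<rho>"
      using quasi_metric.cross_ratio_dense_imp_apollonian_dense[OF intros]
      by (cases v) fastforce
  qed
  have UP_SD: "quantitatively_implies ?QM ?UP ?SD" using compose[OF UP_AD AD_SD] .
  have SD_UP: "quantitatively_implies ?QM ?SD ?UP" using compose[OF SD_AD AD_UP] .
  have UP_CR: "quantitatively_implies ?QM ?UP ?CR" using compose[OF UP_AD AD_CR] .
  have CR_UP: "quantitatively_implies ?QM' ?CR ?UP"
    by (rule compose[OF CR_AD quantitatively_implies_subclass[OF AD_UP]]) blast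
  have CR_HD: "quantitatively_implies ?QM' ?CR ?HD"
    by (rule compose[OF CR_UP quantitatively_implies_subclass[OF UP_HD]]) blast
  have CR_SD: "quantitatively_implies ?QM' ?CR ?SD"
    by (rule compose[OF CR_AD quantitatively_implies_subclass[OF AD_SD]]) blast
  show ?thesis
    unfolding Let_def quantitatively_equivalent_def
    using UP_HD HD_UP UP_SD SD_UP compose[OF HD_UP UP_SD] compose[OF SD_UP UP_HD]
      UP_CR compose[OF HD_UP UP_CR] compose[OF SD_AD AD_CR] CR_UP CR_HD CR_SD
    by (intro conjI)
qed

end
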